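(* Let $K$ be a field of characteristic $0$, $n\ge1$, and let $U$ be an associative commutative algebra over $K$ with commuting derivations $\partial_1,\ldots,\partial_n$. Let $\omega=\partial_1\wedge\cdots\wedge\partial_n$, i.e. $\omega(u_1,\ldots,u_n)=\det(\partial_iu_j)_{1\le i,j\le n}$. Then $(U,\cdot,\omega)$ is a strong $n$-Lie-Poisson algebra.
   Context: An $n$-Lie algebra $(U,\omega)$ is a vector space with a skew-symmetric $n$-linear map $\omega$ satisfying $$\omega(u_1,\ldots,u_{n-1},\omega(v_1,\ldots,v_n))=\sum_{i=1}^n\omega(v_1,\ldots,v_{i-1},\omega(u_1,\ldots,u_{n-1},v_i),v_{i+1},\ldots,v_n)$$ (for $n=1$ any linear map is allowed). An $n$-Lie-Poisson algebra $(U,\cdot,\omega)$ consists of an associative commutative algebra $(U,\cdot)$ and an $n$-Lie algebra $(U,\omega)$ such that $\omega(u\cdot u',u_2,\ldots,u_n)=u\cdot\omega(u',u_2,\ldots,u_n)+u'\cdot\omega(u,u_2,\ldots,u_n)$. It is strong if for all $u_i,v_j\in U$ $$\sum_{i=1}^{n+1}(-1)^i\omega(u_1,\ldots,u_{n-1},v_i)\cdot\omega(v_1,\ldots,\widehat{v_i},\ldots,v_{n+1})=0,$$ where a hat means omission. *)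

theory Defs
  imports Jordan_Normal_Form.Determinant
begin

text \<open>
  Algebras are not required to have a unit, hence class \<^class>\<open>comm_ring\<close> rather than
  \<^class>\<open>comm_ring_1\<close>. Integer signs therefore act through the scalar field.
\<close>

locale comm_assoc_algebra = vector_space scale
  for scale :: "'k::field \<Rightarrow> 'a::comm_ring \<Rightarrow> 'a" +
  assumes scale_mult_left: "scale c (x * y) = scale c x * y"

definition is_derivation :: "('k::field \<Rightarrow> 'a::comm_ring \<Rightarrow> 'a) \<Rightarrow> ('a \<Rightarrow> 'a) \<Rightarrow> bool" where
  "is_derivation scale d \<longleftrightarrow>
     Vector_Spaces.linear scale scale d \<and> (\<forall>x y. d (x * y) = d x * y + x * d y)"

text \<open>
  An \<open>n\<close>-ary operation is a function on lists of which only the values on lists of length \<open>n\<close>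
  matter. Argument positions are counted from \<open>0\<close>.
\<close>

definition multilinear ::
    "('k::field \<Rightarrow> 'a::ab_group_add \<Rightarrow> 'a) \<Rightarrow> nat \<Rightarrow> ('a list \<Rightarrow> 'a) \<Rightarrow> bool" where
  "multilinear scale n \<omega> \<longleftrightarrow>
     (\<forall>us i. length us = n \<longrightarrow> i < n \<longrightarrow> Vector_Spaces.linear scale scale (\<lambda>x. \<omega> (us[i := x])))"

definition skew_symmetric ::
    "('k::field \<Rightarrow> 'a::ab_group_add \<Rightarrow> 'a) \<Rightarrow> nat \<Rightarrow> ('a list \<Rightarrow> 'a) \<Rightarrow> bool" where
  "skew_symmetric scale n \<omega> \<longleftrightarrow>
     (\<forall>us p. length us = n \<longrightarrow> p permutes {..<n} \<longrightarrow>
        \<omega> (permute_list p us) = scale (of_int (sign p)) (\<omega> us))"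

locale n_Lie_algebra = vector_space scale
  for scale :: "'k::field \<Rightarrow> 'a::ab_group_add \<Rightarrow> 'a" +
  fixes n :: nat and \<omega> :: "'a list \<Rightarrow> 'a"
  assumes n_ge_1: "n \<ge> 1"
    and multilinear: "multilinear scale n \<omega>"
    and skew_symmetric: "skew_symmetric scale n \<omega>"
    and Filippov_identity: "length us = n - 1 \<Longrightarrow> length vs = n \<Longrightarrow>
          \<omega> (us @ [\<omega> vs]) = (\<Sum>i<n. \<omega> (vs[i := \<omega> (us @ [vs ! i])]))"

locale n_Lie_Poisson_algebra = comm_assoc_algebra scale + n_Lie_algebra scale n \<omega>
  for scale :: "'k::field \<Rightarrow> 'a::comm_ring \<Rightarrow> 'a" and n :: nat and \<omega> :: "'a list \<Rightarrow> 'a" +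
  assumes Leibniz: "length us = n - 1 \<Longrightarrow>
          \<omega> ((u * u') # us) = u * \<omega> (u' # us) + u' * \<omega> (u # us)"

text \<open>
  The sign exponent is \<^term>\<open>Suc i\<close> because \<^term>\<open>vs ! i\<close> is the argument $v_{i+1}$; the list
  \<^term>\<open>take i vs @ drop (Suc i) vs\<close> is \<^term>\<open>vs\<close> with that argument omitted.
\<close>

locale strong_n_Lie_Poisson_algebra = n_Lie_Poisson_algebra scale n \<omega>
  for scale :: "'k::field \<Rightarrow> 'a::comm_ring \<Rightarrow> 'a" and n :: nat and \<omega> :: "'a list \<Rightarrow> 'a" +
  assumes strong: "length us = n - 1 \<Longrightarrow> length vs = n + 1 \<Longrightarrow>
          (\<Sum>i<n+1. scale ((-1) ^ Suc i)
             (\<omega> (us @ [vs ! i]) * \<omega> (take i vs @ drop (Suc i) vs))) = 0"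

text \<open>
  Without a unit there is no empty product, so \<open>prod_upto f m\<close> is the product
  $f(0) \cdots f(m)$ of \<open>m + 1\<close> factors.
\<close>

primrec prod_upto :: "(nat \<Rightarrow> 'a::comm_ring) \<Rightarrow> nat \<Rightarrow> 'a" where
  "prod_upto f 0 = f 0"
| "prod_upto f (Suc m) = prod_upto f m * f (Suc m)"

text \<open>
  The Leibniz formula for the determinant of $(A_{ij})_{0 \le i,j < n}$, meant for \<open>n \<ge> 1\<close>. The
  library determinants need a unit; \<open>alg_det_eq_det\<close> below shows the agreement when there is one.
\<close>

definition alg_det ::
    "('k::field \<Rightarrow> 'a::comm_ring \<Rightarrow> 'a) \<Rightarrow> nat \<Rightarrow> (nat \<Rightarrow> nat \<Rightarrow> 'a) \<Rightarrow> 'a" where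
  "alg_det scale n A =
     (\<Sum>p | p permutes {..<n}. scale (of_int (sign p)) (prod_upto (\<lambda>i. A i (p i)) (n - 1)))"

lemma prod_upto_eq_prod: "prod_upto f m = (\<Prod>i\<le>m. f i)" for f :: "nat \<Rightarrow> 'a::comm_ring_1"
  by (induction m) simp_all

lemma alg_det_eq_det:
  fixes scale :: "'k::field \<Rightarrow> 'a::comm_ring_1 \<Rightarrow> 'a"
  assumes "comm_assoc_algebra scale" and "n \<ge> 1"
  shows "alg_det scale n A = Determinant.det (mat n n (\<lambda>(i, j). A i j))"
proof -
  interpret comm_assoc_algebra scale by fact
  have sgn: "scale (of_int (sign p)) x = of_int (sign p) * x" for p :: "nat \<Rightarrow> nat" and x
    by (cases "evenperm p") (simp_all add: sign_def)
  have "{..n - 1} = {0..<n}"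
    using assms(2) by auto
  moreover have "(\<Prod>i = 0..<n. A i (p i)) = (\<Prod>i = 0..<n. mat n n (\<lambda>(i, j). A i j) $$ (i, p i))"
    if "p permutes {0..<n}" for p
    using that by (intro prod.cong) (auto simp: permutes_in_image[OF that])
  ultimately show ?thesis
    by (simp add: alg_det_def det_def sgn prod_upto_eq_prod lessThan_atLeast0)
qed

definition wedge ::
    "('k::field \<Rightarrow> 'a::comm_ring \<Rightarrow> 'a) \<Rightarrow> nat \<Rightarrow> (nat \<Rightarrow> 'a \<Rightarrow> 'a) \<Rightarrow> 'a list \<Rightarrow> 'a" where
  "wedge scale n D us = alg_det scale n (\<lambda>i j. D i (us ! j))"

end

theory Submission
  imports Defs
begin

text \<open>
  Apart from homogeneity, the axioms involve only integer scalars, so they may be checked in the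
  unitization of the algebra by the integers, where the usual determinant is available and a
  derivation extends by killing the unit.

  Write $\omega(u_1, \ldots, u_{n-1}, x) = \sum_k c_k\, \partial_k x$, with $c_k$ the cofactors of the
  last gradient. Strongness then says that a determinant with a repeated row vanishes. For the
  Filippov identity, commutativity of the derivations gives
  $\partial_k \omega(v) = \sum_i \omega(\ldots, \partial_k v_i, \ldots)$, so the two sides differ by
  $\sum_k \sum_i \partial_k v_i\, \omega(\ldots, c_k, \ldots)$ with $c_k$ in position $i$. By Cramer's
  rule this is $(\sum_k \partial_k c_k)\, \omega(v)$, and $\sum_k \partial_k c_k = 0$ (Piola).
\<close>

section \<open>Adjoining a unit\<close>

definition int_scale :: "int \<Rightarrow> 'a::ab_group_add \<Rightarrow> 'a" where
  "int_scale m x = (\<Sum>i<nat m. x) - (\<Sum>i<nat (- m). x)"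

lemma int_scale_0 [simp]: "int_scale 0 x = 0"
  by (simp add: int_scale_def)

text \<open>Since \<open>nat\<close> truncates at 0, at most one of the two sums is nonempty. This
  and \<open>int_scale_pred\<close> carry the two-sided inductions below.\<close>

lemma int_scale_succ: "int_scale (m + 1) x = int_scale m x + x"
proof (cases "m \<ge> 0")
  case True
  then show ?thesis by (simp add: int_scale_def nat_add_distrib)
next
  case False
  then have "nat (- m) = Suc (nat (- (m + 1)))" by simp
  with False show ?thesis by (simp add: int_scale_def)
qed

lemma int_scale_pred: "int_scale (m - 1) x = int_scale m x - x"
  using int_scale_succ[of "m - 1" x] by simp

lemma int_scale_1 [simp]: "int_scale 1 x = x"
  using int_scale_succ[of 0 x] by simp

lemma int_scale_add_left: "int_scale (m + k) x = int_scale m x + int_scale k x"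
proof (induction m rule: int_induct[where k = 0])
  case base
  show ?case by simp
next
  case (step1 m)
  have "m + 1 + k = (m + k) + 1" by simp
  with step1 show ?case by (simp only: int_scale_succ) (simp add: algebra_simps)
next
  case (step2 m)
  have "m - 1 + k = (m + k) - 1" by simp
  with step2 show ?case by (simp only: int_scale_pred) (simp add: algebra_simps)
qed

lemma int_scale_add_right: "int_scale m (x + y) = int_scale m x + int_scale m y"
  by (simp add: int_scale_def sum.distrib)

lemma int_scale_0_right [simp]: "int_scale m 0 = 0"
  by (simp add: int_scale_def)

lemma int_scale_minus_left: "int_scale (- m) x = - int_scale m x"
  by (simp add: int_scale_def)

lemma int_scale_mult: "int_scale (m * k) x = int_scale m (int_scale k x)"
proof (induction m rule: int_induct[where k = 0])
  case (step1 m)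
  then show ?case by (simp add: distrib_right int_scale_add_left)
next
  case (step2 m)
  have "(m - 1) * k = m * k + (- k)" by (simp add: algebra_simps)
  with step2 show ?case
    by (simp only: int_scale_add_left int_scale_minus_left int_scale_pred) simp
qed simp

lemma int_scale_mult_left: "int_scale m x * y = int_scale m (x * y)" for x y :: "'a::comm_ring"
proof (induction m rule: int_induct[where k = 0])
  case (step1 m)
  then show ?case by (simp add: distrib_right int_scale_succ)
next
  case (step2 m)
  then show ?case by (simp add: left_diff_distrib int_scale_pred)
qed simp

lemma int_scale_mult_right: "x * int_scale m y = int_scale m (x * y)" for x y :: "'a::comm_ring"
  using int_scale_mult_left[of m y x] by (simp add: mult.commute)

section \<open>The unitization as a commutative ring with one\<close>

datatype 'a unitization = Unitization (unit_part: int) (ideal_part: 'a)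

instantiation unitization :: (comm_ring) comm_ring_1
begin

definition "0 = Unitization 0 0"
definition "1 = Unitization 1 0"
definition "a + b = Unitization (unit_part a + unit_part b) (ideal_part a + ideal_part b)"
definition "a - b = Unitization (unit_part a - unit_part b) (ideal_part a - ideal_part b)"
definition "- a = Unitization (- unit_part a) (- ideal_part a)"
text \<open>This is the expanded product of m + x and k + y. The unit is adjoined over the integers
  because the field action \<open>scale\<close> is only a locale parameter and cannot enter a class
  instance.\<close>

definition "a * b = Unitization (unit_part a * unit_part b)
  (int_scale (unit_part a) (ideal_part b) + int_scale (unit_part b) (ideal_part a)
    + ideal_part a * ideal_part b)"

instance
proof
  fix a b c :: "'a unitization"
  show "a * b * c = a * (b * c)"
    by (simp add: times_unitization_def int_scale_add_left int_scale_add_right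
        int_scale_mult[symmetric] int_scale_mult_left int_scale_mult_right distrib_left distrib_right
        mult_ac add_ac)
  show "(a + b) * c = a * c + b * c"
    by (simp add: times_unitization_def plus_unitization_def int_scale_add_left
        int_scale_add_right distrib_left distrib_right add_ac)
qed (simp_all add: zero_unitization_def one_unitization_def plus_unitization_def
    minus_unitization_def uminus_unitization_def times_unitization_def add_ac mult_ac)

end

text \<open>Injective, additive and multiplicative, so an identity in the algebra may be checked on
  its image; every bracket axiom except homogeneity is pulled back this way.\<close>

definition of_ideal :: "'a::comm_ring \<Rightarrow> 'a unitization" where
  "of_ideal x = Unitization 0 x"

lemma of_ideal_inject [simp]: "of_ideal x = of_ideal y \<longleftrightarrow> x = y"
  by (simp add: of_ideal_def)

lemma of_ideal_0 [simp]: "of_ideal 0 = 0"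
  by (simp add: of_ideal_def zero_unitization_def)

lemma of_ideal_add: "of_ideal (x + y) = of_ideal x + of_ideal y"
  by (simp add: of_ideal_def plus_unitization_def)

lemma of_ideal_minus: "of_ideal (- x) = - of_ideal x"
  by (simp add: of_ideal_def uminus_unitization_def)

lemma of_ideal_mult: "of_ideal (x * y) = of_ideal x * of_ideal y"
  by (simp add: of_ideal_def times_unitization_def)

lemma of_ideal_sum: "of_ideal (sum f A) = (\<Sum>x\<in>A. of_ideal (f x))"
  by (induction A rule: infinite_finite_induct) (simp_all add: of_ideal_add)

lemma of_ideal_prod_upto: "of_ideal (prod_upto f m) = (\<Prod>i\<le>m. of_ideal (f i))"
  by (induction m) (simp_all add: of_ideal_mult)

section \<open>Determinants as functions of their rows\<close>

text \<open>Rows are total functions so that replacing a row, and with it an argument of the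
  bracket, is a function update; only entries with both indices below \<open>n\<close>
  count.\<close>

definition row_det :: "nat \<Rightarrow> (nat \<Rightarrow> nat \<Rightarrow> 'b::comm_ring_1) \<Rightarrow> 'b" where
  "row_det n r = Determinant.det (mat n n (\<lambda>(i, j). r i j))"

definition std_row :: "nat \<Rightarrow> nat \<Rightarrow> 'b::comm_ring_1" where
  "std_row k j = (if j = k then 1 else 0)"

lemma row_det_cong:
  assumes "\<And>i j. i < n \<Longrightarrow> j < n \<Longrightarrow> r i j = s i j"
  shows "row_det n r = row_det n s"
proof -
  have "mat n n (\<lambda>(i, j). r i j) = mat n n (\<lambda>(i, j). s i j)"
    using assms by (intro eq_matI) auto
  then show ?thesis by (simp add: row_det_def)
qed

lemma row_det_Leibniz:
  "row_det n r = (\<Sum>p | p permutes {0..<n}. of_int (sign p) * (\<Prod>i = 0..<n. r i (p i)))"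
proof -
  have "(\<Prod>i = 0..<n. mat n n (\<lambda>(i, j). r i j) $$ (i, p i)) = (\<Prod>i = 0..<n. r i (p i))"
    if "p permutes {0..<n}" for p
    using that by (intro prod.cong) (auto simp: permutes_in_image[OF that])
  then show ?thesis by (simp add: row_det_def det_def)
qed

text \<open>Each Leibniz term has exactly one factor from row \<open>l\<close>. The index set stays
  general so that two-term sums, the zero row and expansions in standard rows are all
  instances.\<close>

lemma row_det_linear_row:
  assumes "l < n"
  shows "row_det n (r(l := \<lambda>j. \<Sum>k\<in>S. a k * w k j)) = (\<Sum>k\<in>S. a k * row_det n (r(l := w k)))"
proof -
  have split: "(\<Prod>i = 0..<n. (r(l := x)) i (p i)) = x (p l) * (\<Prod>i\<in>{0..<n} - {l}. r i (p i))"
    for x and p :: "nat \<Rightarrow> nat"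
    using assms by (subst prod.remove[of _ l]) auto
  show ?thesis
    unfolding row_det_Leibniz split
    by (simp only: sum_distrib_left sum_distrib_right, subst sum.swap, intro sum.cong refl)
      (simp add: mult_ac)
qed

lemma row_det_add_row:
  assumes "l < n"
  shows "row_det n (r(l := \<lambda>j. a * x j + b * y j))
    = a * row_det n (r(l := x)) + b * row_det n (r(l := y))"
  using row_det_linear_row[OF assms, of r "\<lambda>k. if k then a else b" "\<lambda>k. if k then x else y" UNIV]
  by (simp add: UNIV_bool add.commute)

lemma row_det_zero_row:
  assumes "l < n"
  shows "row_det n (r(l := \<lambda>j. 0)) = 0"
  using row_det_linear_row[OF assms, of r _ _ "{}"] by simp

text \<open>The cofactors appear here as determinants with a standard row, hence they can themselves
  be differentiated and expanded again.\<close>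

lemma row_det_expand:
  assumes "l < n"
  shows "row_det n (r(l := x)) = (\<Sum>k<n. x k * row_det n (r(l := std_row k)))"
proof -
  have "row_det n (r(l := x)) = row_det n (r(l := \<lambda>j. \<Sum>k<n. x k * std_row k j))"
  proof (rule row_det_cong)
    fix i j assume "i < n" "j < n"
    have "(\<Sum>k<n. x k * std_row k j) = (\<Sum>k<n. if j = k then x k else 0)"
      by (intro sum.cong) (auto simp: std_row_def)
    with \<open>j < n\<close> show "(r(l := x)) i j = (r(l := \<lambda>j. \<Sum>k<n. x k * std_row k j)) i j"
      by simp
  qed
  then show ?thesis by (simp add: row_det_linear_row[OF assms])
qed

lemma row_det_identical_rows:
  assumes "i < n" "j < n" "i \<noteq> j" "r i = r j"
  shows "row_det n r = 0"
  unfolding row_det_def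
  using assms by (intro det_identical_rows[of _ n i j]) (auto intro!: eq_vecI)

lemma row_det_permute_rows:
  assumes "p permutes {0..<n}"
  shows "row_det n (\<lambda>i. r (p i)) = of_int (sign p) * row_det n r"
proof -
  have "row_det n (\<lambda>i. r (p i))
      = Determinant.det (mat n n (\<lambda>(i, j). mat n n (\<lambda>(i, j). r i j) $$ (p i, j)))"
    unfolding row_det_def using permutes_in_image[OF assms]
    by (intro arg_cong[of _ _ Determinant.det] eq_matI) auto
  also have "\<dots> = of_int (sign p) * row_det n r"
    by (subst det_permute_rows[OF _ assms]) (simp_all add: row_det_def)
  finally show ?thesis .
qed

lemma row_det_swap_rows:
  assumes "l < n" "m < n" "l \<noteq> m"
  shows "row_det n (r(l := x, m := y)) = - row_det n (r(l := y, m := x))"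
proof -
  have "row_det n (\<lambda>i. (r(l := y, m := x)) (transpose l m i))
      = of_int (sign (transpose l m)) * row_det n (r(l := y, m := x))"
    using assms by (intro row_det_permute_rows permutes_swap_id) auto
  moreover have "(\<lambda>i. (r(l := y, m := x)) (transpose l m i)) = r(l := x, m := y)"
    using assms(3) by (auto simp: fun_eq_iff transpose_def)
  ultimately show ?thesis using assms(3) by (simp add: sign_swap_id)
qed

section \<open>Cofactors and Cramer's rule\<close>

lemma row_det_cofactor:
  assumes "l < n"
  shows "row_det n (r(l := x)) = (\<Sum>k<n. x k * cofactor (mat n n (\<lambda>(i, j). r i j)) l k)"
proof -
  let ?B = "mat n n (\<lambda>(i, j). (r(l := x)) i j)"
  \<comment> \<open>The two matrices differ only in row \<open>l\<close>, which is deleted.\<close>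
  have "mat_delete ?B l k = mat_delete (mat n n (\<lambda>(i, j). r i j)) l k" for k
    using assms by (intro eq_matI) (auto simp: mat_delete_def)
  then have cof: "cofactor ?B l k = cofactor (mat n n (\<lambda>(i, j). r i j)) l k" for k
    by (simp add: cofactor_def)
  have "row_det n (r(l := x)) = (\<Sum>k<n. ?B $$ (l, k) * cofactor ?B l k)"
    unfolding row_det_def using assms by (intro laplace_expansion_row) auto
  also have "\<dots> = (\<Sum>k<n. x k * cofactor (mat n n (\<lambda>(i, j). r i j)) l k)"
    using assms by (intro sum.cong refl, subst cof) simp
  finally show ?thesis .
qed

text \<open>Once each determinant is expanded along its replaced row, the coefficient of
  \<open>x m\<close> is the \<open>(m, k)\<close> entry of adj(A) A = det(A) I. This is
  division-free Cramer's rule for writing \<open>x\<close> as a combination of the rows.\<close>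

lemma row_det_Cramer:
  assumes "k < n"
  shows "(\<Sum>i<n. r i k * row_det n (r(i := x))) = x k * row_det n r"
proof -
  let ?A = "mat n n (\<lambda>(i, j). r i j)"
  have A: "?A \<in> carrier_mat n n" by simp
  have cof: "(\<Sum>i<n. r i k * cofactor ?A i m) = (if m = k then row_det n r else 0)" if "m < n" for m
  proof -
    have "(adj_mat ?A * ?A) $$ (m, k) = (\<Sum>i<n. r i k * cofactor ?A i m)"
      using that assms by (auto simp: adj_mat_def scalar_prod_def lessThan_atLeast0 mult.commute
          intro!: sum.cong)
    moreover have "(adj_mat ?A * ?A) $$ (m, k) = (if m = k then row_det n r else 0)"
      using that assms by (simp add: adj_mat(3)[OF A] row_det_def)
    ultimately show ?thesis by (rule trans[OF sym])
  qed
  have "(\<Sum>i<n. r i k * row_det n (r(i := x)))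
      = (\<Sum>i<n. \<Sum>m<n. x m * (r i k * cofactor ?A i m))"
    by (intro sum.cong) (simp_all add: row_det_cofactor sum_distrib_left mult_ac)
  also have "\<dots> = (\<Sum>m<n. x m * (\<Sum>i<n. r i k * cofactor ?A i m))"
    by (subst sum.swap) (simp add: sum_distrib_left)
  also have "\<dots> = (\<Sum>m<n. if m = k then x k * row_det n r else 0)"
    by (intro sum.cong) (auto simp: cof)
  finally show ?thesis using assms by simp
qed

text \<open>The sum is the determinant with the row \<^term>\<open>\<lambda>i. r i k\<close> put on top of the
  transposed array, which therefore has that row twice.\<close>

lemma row_det_alternating_sum:
  assumes "k < n"
  shows "(\<Sum>i<n + 1. (- 1) ^ i * (r i k * row_det n (\<lambda>j. r (if j < i then j else Suc j)))) = 0"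
proof -
  let ?A = "mat (Suc n) (Suc n) (\<lambda>(i, j). r j (if i = 0 then k else i - 1))"
  have "Determinant.det ?A = 0"
    using assms by (intro det_identical_rows[of _ "Suc n" 0 "Suc k"]) (auto intro!: eq_vecI)
  moreover have "Determinant.det (mat_delete ?A 0 i)
      = row_det n (\<lambda>j. r (if j < i then j else Suc j))" if "i < Suc n" for i
  proof -
    have "mat_delete ?A 0 i
        = transpose_mat (mat n n (\<lambda>(a, b). r (if a < i then a else Suc a) b))"
      by (intro eq_matI) (auto simp: mat_delete_def)
    then show ?thesis
      by (simp add: row_det_def Determinant.det_transpose[of _ n])
  qed
  moreover have "Determinant.det ?A = (\<Sum>i<Suc n. ?A $$ (0, i) * cofactor ?A 0 i)"
    by (rule laplace_expansion_row) auto
  ultimately show ?thesis by (simp add: cofactor_def mult_ac)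
qed

section \<open>Derivations and the wedge bracket over a unital ring\<close>

locale ring_derivation =
  fixes d :: "'b::comm_ring_1 \<Rightarrow> 'b"
  assumes add: "d (x + y) = d x + d y"
    and mult: "d (x * y) = d x * y + x * d y"
begin

lemma zero [simp]: "d 0 = 0"
  using add[of 0 0] by simp

lemma one [simp]: "d 1 = 0"
  using mult[of 1 1] by simp

lemma minus: "d (- x) = - d x"
  using add[of x "- x"] by (simp add: eq_neg_iff_add_eq_0 add.commute)

lemma sum: "d (sum f A) = (\<Sum>x\<in>A. d (f x))"
  by (induction A rule: infinite_finite_induct) (simp_all add: add)

lemma sign_mult: "d (of_int (sign p) * x) = of_int (sign p) * d x"
  by (cases "evenperm p") (simp_all add: sign_def minus)

lemma std_row [simp]: "d (std_row k j) = 0"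
  by (simp add: std_row_def)

text \<open>The product rule is phrased with a function update so that each summand is again a
  product over all of \<open>A\<close>; in a Leibniz term this becomes a row replacement.\<close>

lemma prod:
  assumes "finite A"
  shows "d (prod f A) = (\<Sum>x\<in>A. \<Prod>y\<in>A. (f(x := d (f x))) y)"
  using assms
proof (induction A rule: finite_induct)
  case (insert a A)
  have "(\<Sum>x\<in>A. \<Prod>y\<in>insert a A. (f(x := d (f x))) y)
      = (\<Sum>x\<in>A. f a * (\<Prod>y\<in>A. (f(x := d (f x))) y))"
    using insert.hyps by (intro sum.cong) auto
  moreover have "(\<Prod>y\<in>insert a A. (f(a := d (f a))) y) = d (f a) * prod f A"
    using insert.hyps by (auto intro!: arg_cong[of _ _ "(*) (d (f a))"] prod.cong)
  ultimately show ?case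
    using insert by (simp add: mult sum_distrib_left)
qed simp

lemma row_det: "d (row_det n r) = (\<Sum>l<n. row_det n (r(l := \<lambda>j. d (r l j))))"
proof -
  \<comment> \<open>Differentiating factor \<open>l\<close> of a Leibniz term amounts to
    differentiating row \<open>l\<close>, whatever \<open>p\<close> is.\<close>
  have "(\<Prod>i = 0..<n. ((\<lambda>i. r i (p i))(l := d (r l (p l)))) i)
      = (\<Prod>i = 0..<n. (r(l := \<lambda>j. d (r l j))) i (p i))" for l and p :: "nat \<Rightarrow> nat"
    by (intro prod.cong) auto
  then show ?thesis
    unfolding row_det_Leibniz
    by (subst sum.swap) (simp add: sum sign_mult prod sum_distrib_left lessThan_atLeast0)
qed

end

text \<open>Off-diagonal terms cancel in pairs. The vanishing diagonal is assumed separately because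
  skew-symmetry yields only \<open>2 * B i i = 0\<close>.\<close>

lemma sum_symmetric_times_alternating:
  fixes H B :: "nat \<Rightarrow> nat \<Rightarrow> 'b::comm_ring_1"
  assumes "\<And>i j. i < n \<Longrightarrow> j < n \<Longrightarrow> H i j = H j i"
    and "\<And>i j. i < n \<Longrightarrow> j < n \<Longrightarrow> B i j = - B j i"
    and "\<And>i. i < n \<Longrightarrow> B i i = 0"
  shows "(\<Sum>i<n. \<Sum>j<n. H i j * B i j) = 0"
  using assms
proof (induction n)
  case (Suc n)
  have "H i n * B i n = - (H n i * B n i)" if "i < n" for i
    using Suc.prems(1,2)[of i n] that by simp
  then have "(\<Sum>i<n. H i n * B i n) = - (\<Sum>i<n. H n i * B n i)"
    by (simp add: sum_negf)
  moreover have "(\<Sum>i<n. \<Sum>j<n. H i j * B i j) = 0"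
    by (rule Suc.IH; rule Suc.prems; simp)
  ultimately show ?case
    by (simp add: sum.distrib Suc.prems(3))
qed simp

section \<open>The bracket given by commuting derivations\<close>

locale commuting_derivations =
  fixes n :: nat and D :: "nat \<Rightarrow> 'b::comm_ring_1 \<Rightarrow> 'b"
  assumes derivation: "i < n \<Longrightarrow> ring_derivation (D i)"
    and commute: "i < n \<Longrightarrow> j < n \<Longrightarrow> D i (D j x) = D j (D i x)"
begin

abbreviation gradient :: "'b \<Rightarrow> nat \<Rightarrow> 'b" where
  "gradient x \<equiv> \<lambda>j. D j x"

text \<open>Gradients are the rows, the transpose of the array in \<open>wedge\<close>, so that row
  operations act on arguments.\<close>

definition bracket :: "(nat \<Rightarrow> 'b) \<Rightarrow> 'b" where
  "bracket u = row_det n (\<lambda>i. gradient (u i))"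

lemma gradient_upd: "(\<lambda>i. gradient ((u(l := x)) i)) = (\<lambda>i. gradient (u i))(l := gradient x)"
  by (simp add: fun_eq_iff)

lemma bracket_upd: "bracket (u(l := x)) = row_det n ((\<lambda>i. gradient (u i))(l := gradient x))"
  by (simp only: bracket_def gradient_upd)

lemma bracket_cong: "(\<And>i. i < n \<Longrightarrow> u i = v i) \<Longrightarrow> bracket u = bracket v"
  unfolding bracket_def by (rule row_det_cong) simp

lemma bracket_add:
  assumes "l < n"
  shows "bracket (u(l := x + y)) = bracket (u(l := x)) + bracket (u(l := y))"
proof -
  have "bracket (u(l := x + y))
      = row_det n ((\<lambda>i. gradient (u i))(l := \<lambda>j. 1 * gradient x j + 1 * gradient y j))"
    unfolding bracket_upd by (rule row_det_cong) (simp add: ring_derivation.add[OF derivation])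
  also have "\<dots> = 1 * bracket (u(l := x)) + 1 * bracket (u(l := y))"
    unfolding bracket_upd by (rule row_det_add_row[OF assms])
  finally show ?thesis by simp
qed

lemma bracket_mult:
  assumes "l < n"
  shows "bracket (u(l := x * y)) = x * bracket (u(l := y)) + y * bracket (u(l := x))"
proof -
  have "bracket (u(l := x * y))
      = row_det n ((\<lambda>i. gradient (u i))(l := \<lambda>j. x * gradient y j + y * gradient x j))"
    unfolding bracket_upd
    by (rule row_det_cong) (simp add: ring_derivation.mult[OF derivation] mult.commute)
  also have "\<dots> = x * bracket (u(l := y)) + y * bracket (u(l := x))"
    unfolding bracket_upd by (rule row_det_add_row[OF assms])
  finally show ?thesis .
qed

lemma bracket_permute:
  assumes "p permutes {0..<n}"
  shows "bracket (\<lambda>i. u (p i)) = of_int (sign p) * bracket u"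
  unfolding bracket_def by (rule row_det_permute_rows[OF assms])

text \<open>The cofactors of row \<open>l\<close>, and thus the components with respect to the
  \<open>D k\<close> of the derivation sending \<open>x\<close> to
  \<open>bracket (u(l := x))\<close>.\<close>

definition coeff :: "nat \<Rightarrow> (nat \<Rightarrow> 'b) \<Rightarrow> nat \<Rightarrow> 'b" where
  "coeff l u k = row_det n ((\<lambda>i. gradient (u i))(l := std_row k))"

lemma bracket_expand:
  assumes "l < n"
  shows "bracket (u(l := x)) = (\<Sum>k<n. coeff l u k * D k x)"
  unfolding bracket_upd coeff_def by (subst row_det_expand[OF assms]) (simp add: mult.commute)

text \<open>Since \<open>D k\<close> commutes with each \<open>D j\<close>, differentiating the
  gradient of \<open>v i\<close> entrywise gives the gradient of \<open>D k (v i)\<close>.\<close>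

lemma derivation_bracket:
  assumes "k < n"
  shows "D k (bracket v) = (\<Sum>i<n. bracket (v(i := D k (v i))))"
proof -
  have "row_det n ((\<lambda>i. gradient (v i))(i := \<lambda>j. D k (gradient (v i) j)))
      = bracket (v(i := D k (v i)))" for i
    unfolding bracket_upd by (rule row_det_cong) (simp add: commute[OF assms])
  then show ?thesis
    by (simp add: bracket_def[of v] ring_derivation.row_det[OF derivation[OF assms]])
qed

lemma bracket_Cramer:
  assumes "k < n"
  shows "(\<Sum>i<n. D k (v i) * bracket (v(i := x))) = D k x * bracket v"
  using row_det_Cramer[OF assms, of "\<lambda>i. gradient (v i)" "gradient x"]
  by (simp only: bracket_upd bracket_def[of v])

text \<open>Expanding the differentiated row in turn, the divergence is the contraction of the symmetric
  second derivatives with minors that are alternating in the two removed columns.\<close>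

lemma coeff_divergence_free:
  assumes "l < n"
  shows "(\<Sum>k<n. D k (coeff l u k)) = 0"
proof -
  let ?R = "\<lambda>i. gradient (u i)"
  let ?M = "\<lambda>i k m. row_det n (?R(l := std_row k, i := std_row m))"
  have D_coeff: "D k (coeff l u k)
      = (\<Sum>i\<in>{..<n} - {l}. \<Sum>m<n. D k (D m (u i)) * ?M i k m)" if "k < n" for k
  proof -
    interpret ring_derivation "D k" using derivation[OF that] .
    let ?T = "\<lambda>i. row_det n (?R(l := std_row k, i := \<lambda>j. D k ((?R(l := std_row k)) i j)))"
    have "D k (coeff l u k) = (\<Sum>i<n. ?T i)"
      unfolding coeff_def by (rule row_det)
    also have "\<dots> = ?T l + (\<Sum>i\<in>{..<n} - {l}. ?T i)"
      using assms by (intro sum.remove) auto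
    \<comment> \<open>Row \<open>l\<close> is a standard row, and its entries 0 and 1 are
      constants.\<close>
    also have "?T l = 0"
      by (simp add: row_det_zero_row[OF assms])
    also have "(\<Sum>i\<in>{..<n} - {l}. ?T i)
        = (\<Sum>i\<in>{..<n} - {l}. \<Sum>m<n. D k (D m (u i)) * ?M i k m)"
      by (intro sum.cong refl, subst row_det_expand) auto
    finally show ?thesis by simp
  qed
  have "(\<Sum>k<n. D k (coeff l u k))
      = (\<Sum>k<n. \<Sum>i\<in>{..<n} - {l}. \<Sum>m<n. D k (D m (u i)) * ?M i k m)"
    by (intro sum.cong) (simp_all add: D_coeff)
  also have "\<dots> = (\<Sum>i\<in>{..<n} - {l}. \<Sum>k<n. \<Sum>m<n. D k (D m (u i)) * ?M i k m)"
    by (rule sum.swap)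
  also have "\<dots> = 0"
  proof (rule sum.neutral, rule ballI, rule sum_symmetric_times_alternating)
    fix i assume i: "i \<in> {..<n} - {l}"
    show "D k (D m (u i)) = D m (D k (u i))" if "k < n" "m < n" for k m
      using that by (rule commute)
    show "?M i k m = - ?M i m k" for k m
      using i assms by (intro row_det_swap_rows) auto
    show "?M i k k = 0" for k
      using i assms by (intro row_det_identical_rows[of i n l]) auto
  qed
  finally show ?thesis .
qed

lemma bracket_Filippov:
  assumes "l < n"
  shows "bracket (u(l := bracket v)) = (\<Sum>i<n. bracket (v(i := bracket (u(l := v i)))))"
proof -
  let ?c = "coeff l u"
  have linear: "bracket (v(i := \<Sum>k<n. x k)) = (\<Sum>k<n. bracket (v(i := x k)))"
    if "i < n" for i x
  proof -
    have "bracket (v(i := \<Sum>k<n. x k))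
        = row_det n ((\<lambda>i. gradient (v i))(i := \<lambda>j. \<Sum>k<n. 1 * gradient (x k) j))"
      unfolding bracket_upd
      by (rule row_det_cong) (simp add: ring_derivation.sum[OF derivation])
    also have "\<dots> = (\<Sum>k<n. 1 * bracket (v(i := x k)))"
      unfolding bracket_upd by (rule row_det_linear_row[OF that])
    finally show ?thesis by simp
  qed
  \<comment> \<open>Each inner bracket is a combination of the \<open>D k (v i)\<close>; linearity
    and the Leibniz rule in slot \<open>i\<close> split every term in two.\<close>
  have "(\<Sum>i<n. bracket (v(i := bracket (u(l := v i)))))
      = (\<Sum>i<n. \<Sum>k<n. ?c k * bracket (v(i := D k (v i))) + D k (v i) * bracket (v(i := ?c k)))"
    by (intro sum.cong) (simp_all add: bracket_expand[OF assms] linear bracket_mult)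
  also have "\<dots> = (\<Sum>k<n. \<Sum>i<n. ?c k * bracket (v(i := D k (v i)))
      + D k (v i) * bracket (v(i := ?c k)))"
    by (rule sum.swap)
  \<comment> \<open>Summed over \<open>i\<close>, the first halves give
    \<open>D k (bracket v)\<close>, and the second halves, by Cramer's rule with \<open>x\<close>
    equal to \<open>?c k\<close>, give the divergence term.\<close>
  also have "\<dots> = (\<Sum>k<n. ?c k * D k (bracket v) + D k (?c k) * bracket v)"
    by (intro sum.cong)
      (simp_all add: sum.distrib sum_distrib_left[symmetric] bracket_Cramer derivation_bracket)
  also have "\<dots> = bracket (u(l := bracket v))"
    by (simp add: sum.distrib sum_distrib_right[symmetric] coeff_divergence_free[OF assms]
        bracket_expand[OF assms, of u "bracket v"])
  finally show ?thesis ..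
qed

text \<open>The coefficients of the first bracket do not depend on \<open>i\<close>; for each
  derivation \<open>D k\<close> there remains an alternating sum that is a determinant with a
  repeated row.\<close>

lemma bracket_strong:
  assumes "l < n"
  shows "(\<Sum>i<n + 1. (- 1) ^ i
    * (bracket (u(l := v i)) * bracket (\<lambda>j. v (if j < i then j else Suc j)))) = 0"
proof -
  let ?b = "\<lambda>i. bracket (\<lambda>j. v (if j < i then j else Suc j))"
  have "(\<Sum>i<n + 1. (- 1) ^ i * (bracket (u(l := v i)) * ?b i))
      = (\<Sum>i<n + 1. \<Sum>k<n. coeff l u k * ((- 1) ^ i * (D k (v i) * ?b i)))"
    by (simp add: bracket_expand[OF assms] sum_distrib_left sum_distrib_right mult_ac)
  also have "\<dots> = (\<Sum>k<n. coeff l u k * (\<Sum>i<n + 1. (- 1) ^ i * (D k (v i) * ?b i)))"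
    by (subst sum.swap) (simp only: sum_distrib_left)
  also have "\<dots> = 0"
  proof (intro sum.neutral ballI)
    fix k assume "k \<in> {..<n}"
    then show "coeff l u k * (\<Sum>i<n + 1. (- 1) ^ i * (D k (v i) * ?b i)) = 0"
      using row_det_alternating_sum[of k n "\<lambda>i. gradient (v i)"]
      by (simp only: bracket_def lessThan_iff mult_zero_right)
  qed
  finally show ?thesis .
qed

end

section \<open>Transfer to the original algebra\<close>

text \<open>Signs are the only scalars in \<open>alg_det\<close>, so its image can be computed
  without any field action on the unitization.\<close>

lemma (in comm_assoc_algebra) of_ideal_scale_sign:
  "of_ideal (scale (of_int (sign p)) x) = of_int (sign p) * of_ideal x"
  by (cases "evenperm p") (simp_all add: sign_def of_ideal_minus)

lemma (in comm_assoc_algebra) of_ideal_scale_minus_one_power: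
  "of_ideal (scale ((- 1) ^ i) x) = (- 1) ^ i * of_ideal x"
  by (cases "even i") (simp_all add: of_ideal_minus)

lemma (in comm_assoc_algebra) of_ideal_alg_det:
  assumes "n \<ge> 1"
  shows "of_ideal (alg_det scale n A) = row_det n (\<lambda>j i. of_ideal (A i j))"
proof -
  \<comment> \<open>Subtraction is truncated: the bound \<open>n - 1\<close> stands for
    \<open>n\<close> factors only when \<open>n \<ge> 1\<close>.\<close>
  have "{..n - 1} = {0..<n}" using assms by auto
  then have "of_ideal (alg_det scale n A) = row_det n (\<lambda>i j. of_ideal (A i j))"
    by (simp add: alg_det_def row_det_Leibniz of_ideal_sum of_ideal_scale_sign of_ideal_prod_upto
        lessThan_atLeast0)
  also have "\<dots> = Determinant.det (transpose_mat (mat n n (\<lambda>(i, j). of_ideal (A i j))))"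
    by (simp add: row_det_def Determinant.det_transpose[of _ n])
  also have "\<dots> = row_det n (\<lambda>j i. of_ideal (A i j))"
    unfolding row_det_def by (intro arg_cong[of _ _ Determinant.det] eq_matI) auto
  finally show ?thesis .
qed

text \<open>The unit has to go to 0, because every derivation vanishes at 1.\<close>

definition unit_extension :: "('a \<Rightarrow> 'a) \<Rightarrow> 'a::comm_ring unitization \<Rightarrow> 'a unitization" where
  "unit_extension d a = of_ideal (d (ideal_part a))"

lemma unit_extension_of_ideal [simp]: "unit_extension d (of_ideal x) = of_ideal (d x)"
  by (simp add: unit_extension_def of_ideal_def)

lemma additive_int_scale:
  assumes "\<And>x y. d (x + y) = d x + d y"
  shows "d (int_scale m x) = int_scale m (d x)"
proof -
  have "d 0 = 0" using assms[of 0 0] by simp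
  then show ?thesis
  proof (induction m rule: int_induct[where k = 0])
    case (step1 m)
    then show ?case by (simp add: int_scale_succ assms)
  next
    case (step2 m)
    then show ?case using assms[of "int_scale (m - 1) x" x] by (simp add: int_scale_pred)
  qed simp
qed

lemma ring_derivation_unit_extension:
  assumes add: "\<And>x y. d (x + y) = d x + d y"
    and mult: "\<And>x y. d (x * y) = d x * y + x * d y"
  shows "ring_derivation (unit_extension d)"
proof
  show "unit_extension d (a + b) = unit_extension d a + unit_extension d b" for a b
    by (simp add: unit_extension_def plus_unitization_def add of_ideal_add)
  show "unit_extension d (a * b) = unit_extension d a * b + a * unit_extension d b" for a b
    by (simp add: unit_extension_def of_ideal_def times_unitization_def plus_unitization_def
        add mult additive_int_scale[of d, OF add] add_ac)
qed

text \<open>This serves homogeneity of the bracket, which cannot be moved to the unitization, where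
  only integers act: scaling one argument scales a single factor of each Leibniz term.\<close>

lemma (in comm_assoc_algebra) prod_upto_scale:
  assumes "l \<le> m" "f l = scale c (g l)" "\<And>i. i \<noteq> l \<Longrightarrow> f i = g i"
  shows "prod_upto f m = scale c (prod_upto g m)"
  using assms(1)
proof (induction m)
  case 0
  with assms(2) show ?case by simp
next
  case (Suc m)
  show ?case
  proof (cases "l = Suc m")
    case True
    have "prod_upto f k = prod_upto g k" if "k \<le> m" for k
      using that True by (induction k) (auto intro!: assms(3) arg_cong2[of _ _ _ _ "(*)"])
    then show ?thesis
      using True assms(2) scale_mult_left[of c "g l" "prod_upto g m"] by (simp add: mult.commute)
  next
    case False
    with Suc show ?thesis by (simp add: assms(3) scale_mult_left)
  qed
qed

theorem corollary6p2:
  fixes scale :: "'k::field_char_0 \<Rightarrow> 'a::comm_ring \<Rightarrow> 'a"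
    and n :: nat
    and D :: "nat \<Rightarrow> 'a \<Rightarrow> 'a"
  assumes "n \<ge> 1"
    and "comm_assoc_algebra scale"
    and "\<And>i. i < n \<Longrightarrow> is_derivation scale (D i)"
    and "\<And>i j. i < n \<Longrightarrow> j < n \<Longrightarrow> D i \<circ> D j = D j \<circ> D i"
  shows "strong_n_Lie_Poisson_algebra scale n (wedge scale n D)"
proof -
  interpret comm_assoc_algebra scale by fact
  have D_linear: "Vector_Spaces.linear scale scale (D i)"
    and D_mult: "D i (x * y) = D i x * y + x * D i y" if "i < n" for i x y
    using assms(3)[OF that] by (auto simp: is_derivation_def)
  have D_add: "D i (x + y) = D i x + D i y" and D_scale: "D i (scale c x) = scale c (D i x)"
    if "i < n" for i c x y
    using D_linear[OF that] by (simp_all add: Vector_Spaces.linear_iff)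
  interpret E: commuting_derivations n "\<lambda>i. unit_extension (D i)"
  proof (rule commuting_derivations.intro)
    show "ring_derivation (unit_extension (D i))" if "i < n" for i
      using that by (intro ring_derivation_unit_extension D_add D_mult)
    show "unit_extension (D i) (unit_extension (D j) x) = unit_extension (D j) (unit_extension (D i) x)"
      if "i < n" "j < n" for i j x
      using fun_cong[OF assms(4)[OF that], of "ideal_part x"]
      by (simp add: unit_extension_def of_ideal_def)
  qed
  let ?\<omega> = "wedge scale n D"
  let ?f = "\<lambda>us i. of_ideal (us ! i) :: 'a unitization"
  have of_ideal_wedge: "of_ideal (?\<omega> us) = E.bracket (?f us)" for us
    by (simp add: wedge_def of_ideal_alg_det[OF assms(1)] E.bracket_def)
  have wedge_upd: "of_ideal (?\<omega> (us[l := x])) = E.bracket ((?f us)(l := of_ideal x))"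
    if "length us = n" for us l x
    unfolding of_ideal_wedge using that by (intro E.bracket_cong) (auto simp: nth_list_update)
  have wedge_snoc: "of_ideal (?\<omega> (us @ [x])) = E.bracket ((?f us)(n - 1 := of_ideal x))"
    if "length us = n - 1" for us x
    unfolding of_ideal_wedge using that assms(1) by (intro E.bracket_cong) (auto simp: nth_append)
  have last: "n - 1 < n" using assms(1) by simp
  show ?thesis
  proof (unfold_locales)
    show "n \<ge> 1" by fact
    show "Defs.multilinear scale n ?\<omega>"
      unfolding Defs.multilinear_def
    proof (intro allI impI)
      fix us :: "'a list" and l assume us: "length us = n" and l: "l < n"
      show "Vector_Spaces.linear scale scale (\<lambda>x. ?\<omega> (us[l := x]))"
        unfolding Vector_Spaces.linear_iff
      proof (intro conjI allI)
        show "vector_space scale" ..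
        then show "vector_space scale" .
        show "?\<omega> (us[l := x + y]) = ?\<omega> (us[l := x]) + ?\<omega> (us[l := y])" for x y
        proof -
          have "of_ideal (?\<omega> (us[l := x + y])) = of_ideal (?\<omega> (us[l := x]) + ?\<omega> (us[l := y]))"
            using E.bracket_add[OF l] by (simp add: wedge_upd[OF us] of_ideal_add)
          then show ?thesis by (simp only: of_ideal_inject)
        qed
        show "?\<omega> (us[l := scale c x]) = scale c (?\<omega> (us[l := x]))" for c x
        proof -
          have "prod_upto (\<lambda>i. D i (us[l := scale c x] ! p i)) (n - 1)
              = scale c (prod_upto (\<lambda>i. D i (us[l := x] ! p i)) (n - 1))"
            if p: "p permutes {..<n}" for p
          proof -
            \<comment> \<open>In the Leibniz term of \<open>p\<close>, \<open>D q\<close> is the one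
              derivation applied to argument \<open>l\<close>.\<close>
            obtain q where q: "p q = l" "q < n"
              using permutes_image[OF p] l by (metis imageE lessThan_iff)
            show ?thesis
            proof (rule prod_upto_scale)
              show "q \<le> n - 1" using q by simp
              show "D q (us[l := scale c x] ! p q) = scale c (D q (us[l := x] ! p q))"
                using l us q by (simp add: D_scale)
              show "D i (us[l := scale c x] ! p i) = D i (us[l := x] ! p i)" if "i \<noteq> q" for i
              proof -
                have "p i \<noteq> l" using that q(1) permutes_inj[OF p] by (auto dest: injD)
                then show ?thesis by simp
              qed
            qed
          qed
          then show ?thesis
            by (simp add: wedge_def alg_det_def scale_sum_right mult.commute)
        qed
      qed
    qed
    show "Defs.skew_symmetric scale n ?\<omega>"
      unfolding Defs.skew_symmetric_def
    proof (intro allI impI)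
      fix us :: "'a list" and p assume us: "length us = n" and p: "p permutes {..<n}"
      then have "of_ideal (?\<omega> (permute_list p us)) = E.bracket (\<lambda>i. ?f us (p i))"
        unfolding of_ideal_wedge by (intro E.bracket_cong) (simp add: permute_list_nth)
      also have "\<dots> = of_ideal (scale (of_int (sign p)) (?\<omega> us))"
        using E.bracket_permute[of p "?f us"] p
        by (simp add: lessThan_atLeast0 of_ideal_scale_sign of_ideal_wedge)
      finally show "?\<omega> (permute_list p us) = scale (of_int (sign p)) (?\<omega> us)" by simp
    qed
  next
    fix us vs :: "'a list" assume us: "length us = n - 1" and vs: "length vs = n"
    have "of_ideal (?\<omega> (us @ [?\<omega> vs])) = of_ideal (\<Sum>i<n. ?\<omega> (vs[i := ?\<omega> (us @ [vs ! i])]))"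
      using E.bracket_Filippov[OF last, of "?f us" "?f vs"]
      by (simp only: of_ideal_sum wedge_upd[OF vs] wedge_snoc[OF us] of_ideal_wedge[of vs])
    then show "?\<omega> (us @ [?\<omega> vs]) = (\<Sum>i<n. ?\<omega> (vs[i := ?\<omega> (us @ [vs ! i])]))" by simp
  next
    fix us :: "'a list" and u u' assume us: "length us = n - 1"
    \<comment> \<open>The head \<open>0\<close> is a placeholder that is overwritten at once; it
      shifts \<open>us\<close> to the positions from 1 on.\<close>
    have wedge_Cons: "of_ideal (?\<omega> (x # us)) = E.bracket ((?f (0 # us))(0 := of_ideal x))" for x
      unfolding of_ideal_wedge by (intro E.bracket_cong) (auto simp: nth_Cons split: nat.split)
    have "of_ideal (?\<omega> ((u * u') # us)) = of_ideal (u * ?\<omega> (u' # us) + u' * ?\<omega> (u # us))"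
      using assms(1) by (simp only: wedge_Cons of_ideal_add of_ideal_mult) (intro E.bracket_mult, simp)
    then show "?\<omega> ((u * u') # us) = u * ?\<omega> (u' # us) + u' * ?\<omega> (u # us)" by simp
  next
    fix us vs :: "'a list" assume us: "length us = n - 1" and vs: "length vs = n + 1"
    have omit: "of_ideal (?\<omega> (take i vs @ drop (Suc i) vs))
        = E.bracket (\<lambda>j. ?f vs (if j < i then j else Suc j))" if "i < n + 1" for i
      unfolding of_ideal_wedge using that vs
      by (intro E.bracket_cong) (auto simp: nth_append min_def)
    \<comment> \<open>The exponent \<open>Suc i\<close> differs from the one in
      \<open>bracket_strong\<close> by one overall sign, which is split off.\<close>
    have "of_ideal (\<Sum>i<n + 1. scale ((- 1) ^ Suc i)
          (?\<omega> (us @ [vs ! i]) * ?\<omega> (take i vs @ drop (Suc i) vs)))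
        = (\<Sum>i<n + 1. - ((- 1) ^ i * (E.bracket ((?f us)(n - 1 := ?f vs i))
            * E.bracket (\<lambda>j. ?f vs (if j < i then j else Suc j)))))"
      unfolding of_ideal_sum
      by (intro sum.cong refl, subst of_ideal_scale_minus_one_power)
        (simp add: of_ideal_mult wedge_snoc[OF us] omit)
    also have "\<dots> = of_ideal 0"
      using E.bracket_strong[OF last, of "?f us" "?f vs"]
      by (simp only: sum_negf of_ideal_0 neg_equal_0_iff_equal)
    finally show "(\<Sum>i<n + 1. scale ((- 1) ^ Suc i)
        (?\<omega> (us @ [vs ! i]) * ?\<omega> (take i vs @ drop (Suc i) vs))) = 0"
      by (simp only: of_ideal_inject)
  qed
qed

end
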